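(* Let $R$ be a non-zero ring with identity (not necessarily commutative), let $n\ge 1$, and let $f(Z)=Z^n-a_1Z^{n-1}+a_2Z^{n-2}+\cdots+(-1)^{n-1}a_{n-1}Z+(-1)^na_n\in R[Z]$. Let $g_i=\sigma_i-a_i\in R[X_1,\dots,X_n]$ for $1\le i\le n$, where $\sigma_1,\dots,\sigma_n$ are the elementary symmetric polynomials in $X_1,\dots,X_n$, and let $f_1,\dots,f_n$ be defined recursively by $f_1(X_1)=f(X_1)$ and $$f_{i+1}(X_1,\dots,X_{i+1})=\frac{f_i(X_1,\dots,X_{i-1},X_{i+1})-f_i(X_1,\dots,X_{i-1},X_i)}{X_{i+1}-X_i},\qquad 1\le i<n.$$ Then: (a) The left ideals of $R[X_1,\dots,X_n]$ generated by $g_1,\dots,g_n$ and by $f_1,\dots,f_n$ are equal; the right ideals generated by $g_1,\dots,g_n$ and by $f_1,\dots,f_n$ are equal; and the two-sided ideals generated by $g_1,\dots,g_n$ and by $f_1,\dots,f_n$ are equal. (b) For every $1\le i\le n$, $$f_i=S_i^{n-(i-1)}-a_1S_i^{n-i}+a_2S_i^{n-(i+1)}+\cdots+(-1)^{n-(i-1)}a_{n-(i-1)},$$ that is, $f_i=S_i^{n-i+1}+\sum_{k=1}^{n-i+1}(-1)^k a_k S_i^{n-i+1-k}$. In particular, each $f_i$ is a symmetric polynomial in $R[X_1,\dots,X_i]$ of degree $n-(i-1)$. (c) For every $1\le i\le n$, $$f_i=(\sigma_1-a_1)S_i^{n-i}-(\sigma_2-a_2)S_i^{n-(i+1)}+\cdots+(-1)^{n-i}(\sigma_{n-(i-1)}-a_{n-(i-1)}),$$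 that is, $f_i=\sum_{k=1}^{n-i+1}(-1)^{k-1}(\sigma_k-a_k)S_i^{n-i+1-k}$.
   Context: In $R[X_1,\dots,X_n]$ and $R[Z]$ the variables commute with each other and with all elements of $R$. For $1\le j\le n$ and $i\ge 0$, $S_j^i=S_j^i(X_1,\dots,X_j)\in R[X_1,\dots,X_j]$ denotes the sum of all monomials $X_1^{\alpha_1}\cdots X_j^{\alpha_j}$ with $\alpha_1+\cdots+\alpha_j=i$ (complete homogeneous symmetric polynomial; the superscript is an index, not a power; $S_j^0=1$). The fraction defining $f_{i+1}$ denotes the (exact) quotient of the division of the numerator by $X_{i+1}-X_i$. *)

theory Defs
  imports "HOL.Hull" "HOL-Library.Poly_Mapping" "HOL-Combinatorics.Permutations"
begin

section \<open>Polynomials over a ring that need not be commutative\<close>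

text \<open>
  A monomial is a finitely supported exponent function, and a polynomial is a finitely supported
  coefficient function on monomials.  With the library's convolution product this type is the
  ring \<open>R[X\<^sub>0, X\<^sub>1, X\<^sub>2, \<dots>]\<close> for every \<open>'a :: ring_1\<close>; since the exponents form a commutative
  monoid, the variables commute with each other and with the coefficients.  The class \<open>ring_1\<close>
  includes \<open>0 \<noteq> 1\<close>, and it does not include commutativity.
  The ring \<open>R[X\<^sub>1, \<dots>, X\<^sub>n]\<close> is the subring \<open>poly_ring n\<close> below.
\<close>

type_synonym monomial = "nat \<Rightarrow>\<^sub>0 nat"
type_synonym 'a mpoly = "monomial \<Rightarrow>\<^sub>0 'a"

text \<open>Likewise \<open>R[Z]\<close> is the type \<open>nat \<Rightarrow>\<^sub>0 'a\<close> (the library type \<open>'a poly\<close> has a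
  multiplication only for commutative \<open>'a\<close>).\<close>

type_synonym 'a upoly = "nat \<Rightarrow>\<^sub>0 'a"

definition var :: "nat \<Rightarrow> 'a::ring_1 mpoly" where
  "var i = Poly_Mapping.single (Poly_Mapping.single i 1) 1"

definition const :: "'a::ring_1 \<Rightarrow> 'a mpoly" where
  "const c = Poly_Mapping.single 0 c"

definition uvar :: "'a::ring_1 upoly" where
  "uvar = Poly_Mapping.single 1 1"

definition uconst :: "'a::ring_1 \<Rightarrow> 'a upoly" where
  "uconst c = Poly_Mapping.single 0 c"

definition eval_upoly :: "'a::ring_1 upoly \<Rightarrow> 'a mpoly \<Rightarrow> 'a mpoly" where
  "eval_upoly f p = (\<Sum>k\<in>Poly_Mapping.keys f. const (Poly_Mapping.lookup f k) * p ^ k)"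

definition poly_ring :: "nat \<Rightarrow> 'a::ring_1 mpoly set" where
  "poly_ring n = {p. \<forall>m\<in>Poly_Mapping.keys p. Poly_Mapping.keys m \<subseteq> {1..n}}"

definition mono_degree :: "monomial \<Rightarrow> nat" where
  "mono_degree m = (\<Sum>i\<in>Poly_Mapping.keys m. Poly_Mapping.lookup m i)"

text \<open>Total degree, with the convention that the zero polynomial has degree 0.\<close>

definition total_degree :: "'a::ring_1 mpoly \<Rightarrow> nat" where
  "total_degree p = Max (insert 0 (mono_degree ` Poly_Mapping.keys p))"

text \<open>
  Substitution of the variable \<open>X\<^bsub>\<rho> i\<^esub>\<close> for each \<open>X\<^sub>i\<close>.  The map \<open>\<rho>\<close> need not be injective, so
  exponents and coefficients that are sent to the same place are added up.
\<close>

definition rename_mono :: "(nat \<Rightarrow> nat) \<Rightarrow> monomial \<Rightarrow> monomial" where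
  "rename_mono \<rho> m =
     (\<Sum>i\<in>Poly_Mapping.keys m. Poly_Mapping.single (\<rho> i) (Poly_Mapping.lookup m i))"

definition rename :: "(nat \<Rightarrow> nat) \<Rightarrow> 'a::ring_1 mpoly \<Rightarrow> 'a mpoly" where
  "rename \<rho> p =
     (\<Sum>m\<in>Poly_Mapping.keys p. Poly_Mapping.single (rename_mono \<rho> m) (Poly_Mapping.lookup p m))"

definition symmetric_in :: "nat \<Rightarrow> 'a::ring_1 mpoly \<Rightarrow> bool" where
  "symmetric_in i p \<longleftrightarrow> p \<in> poly_ring i \<and> (\<forall>\<pi>. \<pi> permutes {1..i} \<longrightarrow> rename \<pi> p = p)"

text \<open>The elementary symmetric polynomial \<open>\<sigma>\<^sub>k\<close> in \<open>X\<^sub>1, \<dots>, X\<^sub>n\<close>: each subset of \<open>{1..n}\<close> with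
  \<open>k\<close> elements gives a squarefree monomial.\<close>

definition elem_sym :: "nat \<Rightarrow> nat \<Rightarrow> 'a::ring_1 mpoly" where
  "elem_sym n k =
     (\<Sum>S | S \<subseteq> {1..n} \<and> card S = k. Poly_Mapping.single (\<Sum>j\<in>S. Poly_Mapping.single j 1) 1)"

definition monomials :: "nat \<Rightarrow> nat \<Rightarrow> monomial set" where
  "monomials j d = {m. Poly_Mapping.keys m \<subseteq> {1..j} \<and> mono_degree m = d}"

text \<open>\<open>complete_sym j d\<close> is \<open>S\<^sub>j\<^sup>d\<close>; the sum in it is over a finite set.\<close>

definition complete_sym :: "nat \<Rightarrow> nat \<Rightarrow> 'a::ring_1 mpoly" where
  "complete_sym j d = (\<Sum>m\<in>monomials j d. Poly_Mapping.single m 1)"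

lemma finite_monomials: "finite (monomials j d)"
proof -
  have "Poly_Mapping.lookup ` monomials j d
          \<subseteq> {f. \<forall>i. (i \<in> {1..j} \<longrightarrow> f i \<in> {0..d}) \<and> (i \<notin> {1..j} \<longrightarrow> f i = 0)}"
  proof clarify
    fix m i assume m: "m \<in> monomials j d"
    have "Poly_Mapping.lookup m i \<le> mono_degree m"
    proof (cases "i \<in> Poly_Mapping.keys m")
      case True
      then show ?thesis unfolding mono_degree_def by (intro member_le_sum) auto
    qed (simp add: in_keys_iff)
    with m show "(i \<in> {1..j} \<longrightarrow> Poly_Mapping.lookup m i \<in> {0..d}) \<and>
        (i \<notin> {1..j} \<longrightarrow> Poly_Mapping.lookup m i = 0)"
      by (auto simp: monomials_def in_keys_iff subset_iff)
  qed
  then have "finite (Poly_Mapping.lookup ` monomials j d)"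
    by (rule finite_subset) (intro finite_set_of_finite_funs; simp)
  then show ?thesis
    by (rule finite_imageD) (simp add: inj_on_def)
qed

text \<open>Ideals of \<open>R[X\<^sub>1, \<dots>, X\<^sub>n]\<close>.  Closure under negation follows from closure under
  multiplication by \<open>- 1\<close>.  The ideal generated by \<open>G\<close> is \<open>left_ideal n hull G\<close>, the least such
  ideal that contains \<open>G\<close>, and similarly for the other two kinds.\<close>

definition left_ideal :: "nat \<Rightarrow> 'a::ring_1 mpoly set \<Rightarrow> bool" where
  "left_ideal n I \<longleftrightarrow> I \<subseteq> poly_ring n \<and> 0 \<in> I \<and> (\<forall>p\<in>I. \<forall>q\<in>I. p + q \<in> I) \<and>
     (\<forall>r\<in>poly_ring n. \<forall>p\<in>I. r * p \<in> I)"

definition right_ideal :: "nat \<Rightarrow> 'a::ring_1 mpoly set \<Rightarrow> bool" where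
  "right_ideal n I \<longleftrightarrow> I \<subseteq> poly_ring n \<and> 0 \<in> I \<and> (\<forall>p\<in>I. \<forall>q\<in>I. p + q \<in> I) \<and>
     (\<forall>r\<in>poly_ring n. \<forall>p\<in>I. p * r \<in> I)"

definition two_sided_ideal :: "nat \<Rightarrow> 'a::ring_1 mpoly set \<Rightarrow> bool" where
  "two_sided_ideal n I \<longleftrightarrow> left_ideal n I \<and> right_ideal n I"


section \<open>The polynomials of the theorem\<close>

definition gen_poly :: "nat \<Rightarrow> (nat \<Rightarrow> 'a::ring_1) \<Rightarrow> 'a upoly" where
  "gen_poly n a = uvar ^ n + (\<Sum>k=1..n. (- 1) ^ k * uconst (a k) * uvar ^ (n - k))"

definition g_poly :: "nat \<Rightarrow> (nat \<Rightarrow> 'a::ring_1) \<Rightarrow> nat \<Rightarrow> 'a mpoly" where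
  "g_poly n a i = elem_sym n i - const (a i)"

text \<open>The quotient of an exact division; it is used only for divisors \<open>X\<^bsub>i+1\<^esub> - X\<^sub>i\<close>, which are
  central and not zero divisors, so that left and right quotients agree and are unique.\<close>

definition exact_quotient :: "'a::ring_1 mpoly \<Rightarrow> 'a mpoly \<Rightarrow> 'a mpoly" where
  "exact_quotient p d = (THE q. d * q = p)"

text \<open>The sequence \<open>f\<^sub>1, f\<^sub>2, \<dots>\<close>; the value at index 0 is a dummy.  In the recursive equation
  \<open>f\<^sub>i(X\<^sub>1, \<dots>, X\<^bsub>i-1\<^esub>, X\<^bsub>i+1\<^esub>)\<close> is obtained by the substitution \<open>X\<^sub>i \<mapsto> X\<^bsub>i+1\<^esub>\<close>, where \<open>i = Suc j\<close>.\<close>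

fun f_poly :: "'a::ring_1 upoly \<Rightarrow> nat \<Rightarrow> 'a mpoly" where
  "f_poly f 0 = 0"
| "f_poly f (Suc 0) = eval_upoly f (var 1)"
| "f_poly f (Suc (Suc j)) =
     (let i = Suc j in
        exact_quotient (rename (id(i := Suc i)) (f_poly f i) - f_poly f i)
          (var (Suc i) - var i))"

end

theory Submission
  imports Defs
begin

text \<open>Since \<open>S\<^sub>i\<^sup>d = S\<^bsub>i-1\<^esub>\<^sup>d + X\<^sub>i S\<^sub>i\<^bsup>d-1\<^esup>\<close>, the divided difference of \<open>S\<^sub>i\<^bsup>d+1\<^esup>\<close> in the last variable is
  \<open>S\<^bsub>i+1\<^esub>\<^sup>d\<close>, and (b) follows by induction on \<open>i\<close>.  As
  \<open>(\<Sum>\<^sub>k (-1)\<^sup>k \<sigma>\<^sub>k t\<^sup>k) (\<Sum>\<^sub>d S\<^sub>i\<^sup>d t\<^sup>d)\<close> is a polynomial of degree \<open>n - i\<close> in \<open>t\<close>, its coefficient of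
  \<open>t\<^bsup>n-i+1\<^esup>\<close> vanishes; subtracting it from (b) gives (c).  By (c) the two families differ by a
  triangular matrix with central entries and \<open>\<plusminus> 1\<close> on the diagonal, hence (a).  The variables and
  the \<open>S\<^sub>i\<^sup>d\<close> are central, which is all the commutativity that is needed.\<close>

section \<open>Expansion into monomials, and central elements\<close>

lemma poly_mapping_expansion:
  fixes p :: "'k \<Rightarrow>\<^sub>0 'b::comm_monoid_add"
  shows "(\<Sum>k\<in>Poly_Mapping.keys p. Poly_Mapping.single k (Poly_Mapping.lookup p k)) = p"
  by (rule poly_mapping_eqI)
    (auto simp: lookup_sum lookup_single when_def in_keys_iff if_distrib cong: if_cong)

text \<open>Monomial by monomial: exponents add commutatively and 1 commutes with every
  coefficient.\<close>

lemma single_one_central: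
  fixes p :: "'k::comm_monoid_add \<Rightarrow>\<^sub>0 'a::semiring_1"
  shows "p * Poly_Mapping.single m 1 = Poly_Mapping.single m 1 * p"
proof -
  have "(\<Sum>k\<in>Poly_Mapping.keys p. Poly_Mapping.single k (Poly_Mapping.lookup p k)) * Poly_Mapping.single m 1
      = Poly_Mapping.single m 1 * (\<Sum>k\<in>Poly_Mapping.keys p. Poly_Mapping.single k (Poly_Mapping.lookup p k))"
    by (simp add: sum_distrib_left sum_distrib_right mult_single add.commute)
  then show ?thesis
    by (simp only: poly_mapping_expansion)
qed

lemma var_central: "p * var i = var i * p"
  unfolding var_def by (rule single_one_central)

lemma complete_sym_central: "p * complete_sym i d = complete_sym i d * p"
  unfolding complete_sym_def by (simp add: sum_distrib_left sum_distrib_right single_one_central)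

lemma var_diff_central: "p * (var i - var j) = (var i - var j) * p"
  by (simp add: algebra_simps var_central)

section \<open>Unique division by a difference of two variables\<close>

lemma lookup_single_one_mult:
  fixes p :: "'k::cancel_comm_monoid_add \<Rightarrow>\<^sub>0 'a::semiring_1"
  shows "Poly_Mapping.lookup (Poly_Mapping.single m 1 * p) (m + k) = Poly_Mapping.lookup p k"
proof -
  have "Poly_Mapping.lookup (Poly_Mapping.single m 1 *
      (\<Sum>k\<in>Poly_Mapping.keys p. Poly_Mapping.single k (Poly_Mapping.lookup p k))) (m + k)
    = Poly_Mapping.lookup p k"
    by (auto simp: sum_distrib_left mult_single lookup_sum lookup_single when_def in_keys_iff)
  then show ?thesis
    by (simp only: poly_mapping_expansion)
qed

text \<open>A monomial of \<open>q\<close> whose exponent at \<open>j\<close> is maximal survives in \<open>X\<^sub>j q\<close> with an exponent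
  that no monomial of \<open>X\<^sub>i q\<close> has.\<close>

lemma var_diff_not_zero_divisor:
  assumes "i \<noteq> j" and eq: "(var j - var i) * q = 0"
  shows "q = 0"
proof (rule ccontr)
  let ?e = "\<lambda>i. Poly_Mapping.single i (1::nat)"
  let ?E = "(\<lambda>m. Poly_Mapping.lookup m j) ` Poly_Mapping.keys q"
  assume "q \<noteq> 0"
  then have ne: "?E \<noteq> {}"
    by (simp add: poly_mapping_eq_iff fun_eq_iff ex_in_conv[symmetric] in_keys_iff)
  then have "Max ?E \<in> ?E" by (intro Max_in) auto
  then obtain m where m: "m \<in> Poly_Mapping.keys q" "Poly_Mapping.lookup m j = Max ?E"
    by auto
  have eq': "var j * q = var i * q"
    using eq by (simp add: algebra_simps)
  have "Poly_Mapping.lookup (var i * q) (?e j + m) = Poly_Mapping.lookup q m"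
    using lookup_single_one_mult[of "?e j" q m] eq' by (simp add: var_def)
  then have "?e j + m \<in> Poly_Mapping.keys (var i * q)"
    using m(1) by (simp add: in_keys_iff)
  then obtain m' where m': "m' \<in> Poly_Mapping.keys q" "?e j + m = ?e i + m'"
    using keys_mult[of "var i" q] by (auto simp: var_def split: if_splits)
  from m'(2) have "Poly_Mapping.lookup (?e j + m) j = Poly_Mapping.lookup (?e i + m') j"
    by simp
  with \<open>i \<noteq> j\<close> have "Poly_Mapping.lookup m' j = Suc (Max ?E)"
    by (simp add: lookup_add lookup_single m(2))
  moreover have "Poly_Mapping.lookup m' j \<le> Max ?E"
    using m'(1) by simp
  ultimately show False by simp
qed

text \<open>Evaluates the definite description: any factorization exhibits the quotient, and
  cancelling \<open>var j - var i\<close> gives uniqueness.\<close>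

lemma exact_quotient_var_diff:
  assumes "i \<noteq> j" and "p = (var j - var i) * q"
  shows "exact_quotient p (var j - var i) = q"
  unfolding exact_quotient_def assms(2)
proof (rule the_equality)
  fix q' assume "(var j - var i) * q' = (var j - var i) * q"
  then have "(var j - var i) * (q' - q) = 0"
    by (simp add: right_diff_distrib)
  then show "q' = q"
    using var_diff_not_zero_divisor[OF assms(1)] by fastforce
qed simp

section \<open>Constants and evaluation of univariate polynomials\<close>

lemma const_one [simp]: "const 1 = 1"
  by (simp add: const_def)

lemma const_minus: "const (- c) = - const c"
  by (simp add: const_def single_uminus)

lemma const_sign: "const ((- 1) ^ k * c) = (- 1) ^ k * const c"
  by (simp add: minus_one_power_iff const_minus)

text \<open>Coefficients may cancel in \<open>p + q\<close> and keys disappear; this is harmless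
  since each summand is additive in the coefficient and vanishes at 0.\<close>

lemma eval_upoly_add: "eval_upoly (p + q) x = eval_upoly p x + eval_upoly q x"
  unfolding eval_upoly_def
  by (rule setsum_keys_plus_distrib) (simp_all add: const_def single_add distrib_right)

lemma eval_upoly_sum:
  "finite A \<Longrightarrow> eval_upoly (sum h A) x = (\<Sum>i\<in>A. eval_upoly (h i) x)"
  by (induction A rule: finite_induct) (simp_all add: eval_upoly_add, simp add: eval_upoly_def)

lemma eval_upoly_single: "eval_upoly (Poly_Mapping.single k c) x = const c * x ^ k"
  by (simp add: eval_upoly_def const_def)

lemma single_power: "Poly_Mapping.single (m :: nat) (1::'a::semiring_1) ^ k = Poly_Mapping.single (k * m) 1"
  by (induction k) (simp_all add: mult_single)

section \<open>Renaming of variables and degrees of monomials\<close>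

lemma rename_mono_add: "rename_mono \<rho> (m + m') = rename_mono \<rho> m + rename_mono \<rho> m'"
  unfolding rename_mono_def
  by (rule setsum_keys_plus_distrib) (simp_all add: single_add)

lemma rename_mono_single: "rename_mono \<rho> (Poly_Mapping.single i k) = Poly_Mapping.single (\<rho> i) k"
  by (simp add: rename_mono_def)

lemma rename_mono_fixed:
  assumes "\<And>i. i \<in> Poly_Mapping.keys m \<Longrightarrow> \<rho> i = i"
  shows "rename_mono \<rho> m = m"
  using assms by (simp add: rename_mono_def poly_mapping_expansion cong: sum.cong)

lemma rename_add: "rename \<rho> (p + q) = rename \<rho> p + rename \<rho> q"
  unfolding rename_def
  by (rule setsum_keys_plus_distrib) (simp_all add: single_add)

lemma rename_zero [simp]: "rename \<rho> 0 = 0"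
  by (simp add: rename_def)

lemma rename_sum: "rename \<rho> (sum h A) = (\<Sum>i\<in>A. rename \<rho> (h i))"
  by (induction A rule: infinite_finite_induct) (simp_all add: rename_add)

lemma rename_single: "rename \<rho> (Poly_Mapping.single m c) = Poly_Mapping.single (rename_mono \<rho> m) c"
  by (simp add: rename_def)

lemma rename_one [simp]: "rename \<rho> 1 = 1"
  using rename_single[of \<rho> 0 1] by (simp add: rename_mono_def)

text \<open>Expanding \<open>p\<close> leaves only the additivity of \<open>rename_mono\<close>. A
  monomial left factor covers multiplication by constants and by variables.\<close>

lemma rename_single_mult:
  "rename \<rho> (Poly_Mapping.single m c * p) = Poly_Mapping.single (rename_mono \<rho> m) c * rename \<rho> p"
proof -
  have "rename \<rho> (Poly_Mapping.single m c *
      (\<Sum>k\<in>Poly_Mapping.keys p. Poly_Mapping.single k (Poly_Mapping.lookup p k)))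
    = Poly_Mapping.single (rename_mono \<rho> m) c *
      rename \<rho> (\<Sum>k\<in>Poly_Mapping.keys p. Poly_Mapping.single k (Poly_Mapping.lookup p k))"
    by (simp add: sum_distrib_left mult_single rename_sum rename_single rename_mono_add)
  then show ?thesis
    by (simp only: poly_mapping_expansion)
qed

lemma rename_const_mult: "rename \<rho> (const c * p) = const c * rename \<rho> p"
  by (simp add: const_def rename_single_mult) (simp add: rename_mono_def)

lemma rename_const: "rename \<rho> (const c) = const c"
  using rename_const_mult[of \<rho> c 1] by simp

lemma rename_var_mult: "rename \<rho> (var i * p) = var (\<rho> i) * rename \<rho> p"
  by (simp add: var_def rename_single_mult rename_mono_single)

lemma mono_degree_add: "mono_degree (m + m') = mono_degree m + mono_degree m'"
  unfolding mono_degree_def by (rule setsum_keys_plus_distrib) simp_all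

lemma mono_degree_single [simp]: "mono_degree (Poly_Mapping.single i k) = k"
  by (simp add: mono_degree_def)

lemma mono_degree_eq_0_iff: "mono_degree m = 0 \<longleftrightarrow> m = 0"
  by (auto simp: mono_degree_def poly_mapping_eq_iff fun_eq_iff in_keys_iff)

lemma mono_degree_sum: "mono_degree (sum h A) = (\<Sum>i\<in>A. mono_degree (h i))"
  by (induction A rule: infinite_finite_induct)
    (simp_all add: mono_degree_add mono_degree_eq_0_iff)

lemma mono_degree_rename_mono: "mono_degree (rename_mono \<rho> m) = mono_degree m"
  unfolding rename_mono_def mono_degree_sum mono_degree_single by (simp only: mono_degree_def)

lemma rename_mono_comp: "rename_mono \<rho> (rename_mono \<tau> m) = rename_mono (\<rho> \<circ> \<tau>) m"
proof -
  have "rename_mono \<rho> (sum h A) = (\<Sum>i\<in>A. rename_mono \<rho> (h i))" for h :: "nat \<Rightarrow> monomial" and A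
    by (induction A rule: infinite_finite_induct)
      (simp_all add: rename_mono_add, simp_all add: rename_mono_def)
  then have "rename_mono \<rho> (rename_mono \<tau> m)
      = (\<Sum>i\<in>Poly_Mapping.keys m. rename_mono \<rho> (Poly_Mapping.single (\<tau> i) (Poly_Mapping.lookup m i)))"
    by (simp add: rename_mono_def[of \<tau>])
  then show ?thesis
    by (simp add: rename_mono_single rename_mono_def[of "\<rho> \<circ> \<tau>"])
qed

lemma keys_rename_mono: "Poly_Mapping.keys (rename_mono \<rho> m) \<subseteq> \<rho> ` Poly_Mapping.keys m"
  unfolding rename_mono_def by (rule order_trans[OF keys_sum]) (auto split: if_splits)

lemma rename_mono_in_monomials:
  assumes "\<pi> permutes {1..j}" "m \<in> monomials j d"
  shows "rename_mono \<pi> m \<in> monomials j d"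
  using assms keys_rename_mono[of \<pi> m] permutes_in_image[OF assms(1)]
  by (fastforce simp: monomials_def mono_degree_rename_mono)

text \<open>A permutation of the variables acts bijectively on \<open>monomials j d\<close>, with
  \<open>inv \<pi>\<close> inducing the inverse, so the sum is only reindexed.\<close>

lemma rename_complete_sym_permutes:
  assumes \<pi>: "\<pi> permutes {1..j}"
  shows "rename \<pi> (complete_sym j d) = complete_sym j d"
proof -
  have inv: "inv \<pi> permutes {1..j}"
    using \<pi> by (rule permutes_inv)
  have id: "rename_mono (inv \<pi>) (rename_mono \<pi> m) = m" "rename_mono \<pi> (rename_mono (inv \<pi>) m) = m" for m
    by (simp_all add: rename_mono_comp permutes_inv_o[OF \<pi>] rename_mono_fixed)
  show ?thesis
    unfolding complete_sym_def rename_sum rename_single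
    by (rule sum.reindex_bij_witness[where i = "rename_mono (inv \<pi>)" and j = "rename_mono \<pi>"])
      (simp_all add: id rename_mono_in_monomials[OF \<pi>] rename_mono_in_monomials[OF inv])
qed

lemma rename_complete_sym_fixed:
  assumes "\<And>i. i \<in> {1..j} \<Longrightarrow> \<rho> i = i"
  shows "rename \<rho> (complete_sym j d) = complete_sym j d"
proof -
  have "rename_mono \<rho> m = m" if "m \<in> monomials j d" for m
    using that by (intro rename_mono_fixed assms) (auto simp: monomials_def)
  then show ?thesis
    by (simp add: complete_sym_def rename_sum rename_single)
qed

section \<open>Recursions for complete and elementary symmetric polynomials\<close>

lemma complete_sym_0 [simp]: "complete_sym j 0 = 1"
proof -
  have "monomials j 0 = {0}"
    by (auto simp: monomials_def mono_degree_eq_0_iff)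
  then show ?thesis
    by (simp add: complete_sym_def)
qed

lemma monomials_zero: "monomials 0 (Suc d) = {}"
  by (auto simp: monomials_def mono_degree_def)

lemma monomials_Suc_Suc:
  "monomials (Suc j) (Suc d)
     = monomials j (Suc d) \<union> (+) (Poly_Mapping.single (Suc j) 1) ` monomials (Suc j) d"
    (is "?L = ?A \<union> (+) ?e ` ?B")
proof (intro equalityI subsetI)
  fix m assume m: "m \<in> ?L"
  show "m \<in> ?A \<union> (+) ?e ` ?B"
  proof (cases "Suc j \<in> Poly_Mapping.keys m")
    case True
    \<comment> \<open>One factor \<open>var (Suc j)\<close> is removed; the truncated subtraction is
      exact because \<open>Suc j\<close> occurs in \<open>m\<close>.\<close>
    define m' where "m' = m - ?e"
    have mm: "m = ?e + m'"
      using True unfolding m'_def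
      by (intro poly_mapping_eqI) (auto simp: lookup_add lookup_minus lookup_single when_def in_keys_iff)
    moreover have "Poly_Mapping.keys m' \<subseteq> Poly_Mapping.keys m"
      unfolding mm by (auto simp: in_keys_iff lookup_add)
    ultimately have "m' \<in> ?B"
      using m by (auto simp: monomials_def mono_degree_add)
    with mm show ?thesis by blast
  next
    case False
    with m have "Poly_Mapping.keys m \<subseteq> {1..j}"
      by (simp add: monomials_def atLeastAtMostSuc_conv subset_insert)
    with m show ?thesis by (auto simp: monomials_def)
  qed
next
  fix m assume "m \<in> ?A \<union> (+) ?e ` ?B"
  then show "m \<in> ?L"
    using keys_add[of ?e] by (fastforce simp: monomials_def mono_degree_add subset_iff)
qed

lemma complete_sym_Suc_Suc:
  "complete_sym (Suc j) (Suc d) = complete_sym j (Suc d) + var (Suc j) * complete_sym (Suc j) d"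
proof -
  let ?e = "Poly_Mapping.single (Suc j) (1::nat)"
  have "Suc j \<in> Poly_Mapping.keys (?e + m)" for m
    by (simp add: in_keys_iff lookup_add)
  then have "monomials j (Suc d) \<inter> (+) ?e ` monomials (Suc j) d = {}"
    by (fastforce simp: monomials_def)
  then show ?thesis
    by (simp add: complete_sym_def monomials_Suc_Suc sum.union_disjoint finite_monomials
        sum.reindex sum_distrib_left mult_single var_def)
qed

lemma complete_sym_zero_Suc [simp]: "complete_sym 0 (Suc d) = 0"
  by (simp add: complete_sym_def monomials_zero)

lemma complete_sym_one: "complete_sym (Suc 0) d = var 1 ^ d"
  by (induction d) (simp_all add: complete_sym_Suc_Suc)

lemma elem_sym_0 [simp]: "elem_sym n 0 = 1"
proof -
  have "{S. S \<subseteq> {1..n} \<and> card S = 0} = {{}}"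
    using finite_subset[of _ "{1..n}"] by auto
  then show ?thesis
    by (simp add: elem_sym_def)
qed

lemma elem_sym_zero_Suc [simp]: "elem_sym 0 (Suc k) = 0"
proof -
  have "{S. S \<subseteq> {1..0::nat} \<and> card S = Suc k} = {}"
    by auto
  then show ?thesis
    by (simp only: elem_sym_def sum.empty)
qed

text \<open>The subsets are split by whether they contain \<open>Suc n\<close>; those that do
  contribute the factor \<open>var (Suc n)\<close>.\<close>

lemma elem_sym_Suc_Suc:
  "elem_sym (Suc n) (Suc k) = elem_sym n (Suc k) + var (Suc n) * elem_sym n k"
proof -
  let ?A = "\<lambda>(n::nat) k. {S. S \<subseteq> {1..n} \<and> card S = k}"
  have fin: "finite (?A n k)" for n k :: nat
    by (rule finite_subset[of _ "Pow {1..n}"]) auto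
  have finS: "S \<subseteq> {1..n} \<Longrightarrow> finite S" for S and n :: nat
    by (auto intro: finite_subset)
  have split: "?A (Suc n) (Suc k) = ?A n (Suc k) \<union> insert (Suc n) ` ?A n k"
  proof (intro equalityI subsetI)
    fix S assume S: "S \<in> ?A (Suc n) (Suc k)"
    show "S \<in> ?A n (Suc k) \<union> insert (Suc n) ` ?A n k"
    proof (cases "Suc n \<in> S")
      case True
      then have "S = insert (Suc n) (S - {Suc n})" by blast
      moreover have "S - {Suc n} \<in> ?A n k"
        using S True by (fastforce simp: le_Suc_eq)
      ultimately show ?thesis by blast
    next
      case False
      with S have "S \<subseteq> {1..n}"
        by (simp add: atLeastAtMostSuc_conv subset_insert)
      with S show ?thesis by auto
    qed
  next
    fix S assume "S \<in> ?A n (Suc k) \<union> insert (Suc n) ` ?A n k"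
    then show "S \<in> ?A (Suc n) (Suc k)"
    proof
      assume "S \<in> insert (Suc n) ` ?A n k"
      then obtain T where T: "T \<subseteq> {1..n}" "card T = k" "S = insert (Suc n) T"
        by auto
      then have "Suc n \<notin> T" by auto
      with T show ?thesis using finS[OF T(1)] by auto
    qed auto
  qed
  have disj: "?A n (Suc k) \<inter> insert (Suc n) ` ?A n k = {}"
    by auto
  have inj: "inj_on (insert (Suc n)) (?A n k)"
    by (rule inj_onI) (auto dest!: insert_ident[THEN iffD1, rotated 2])
  have step: "Poly_Mapping.single (\<Sum>j\<in>insert (Suc n) S. Poly_Mapping.single j 1) 1
      = var (Suc n) * Poly_Mapping.single (\<Sum>j\<in>S. Poly_Mapping.single j 1) (1::'a)"
    if "S \<in> ?A n k" for S
  proof -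
    have "Suc n \<notin> S" using that by auto
    then show ?thesis
      using finS[of S n] that by (simp add: var_def mult_single)
  qed
  show ?thesis
    unfolding elem_sym_def split
    by (simp only: sum.union_disjoint[OF fin finite_imageI[OF fin] disj] sum.reindex[OF inj]
        o_def sum_distrib_left sum.cong[OF refl step])
qed


section \<open>Divided differences of complete symmetric polynomials\<close>

lemma complete_sym_shift_var:
  "rename (id(Suc j := Suc (Suc j))) (complete_sym (Suc j) (Suc d)) - complete_sym (Suc j) (Suc d)
     = (var (Suc (Suc j)) - var (Suc j)) * complete_sym (Suc (Suc j)) d"
proof -
  define \<rho> where "\<rho> = id(Suc j := Suc (Suc j))"
  define x y :: "'a mpoly" where "x = var (Suc j)" and "y = var (Suc (Suc j))"
  define h where "h = (\<lambda>d. complete_sym (Suc j) d :: 'a mpoly)"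
  have fixed: "rename \<rho> (complete_sym j e) = complete_sym j e" for e
    by (rule rename_complete_sym_fixed) (simp add: \<rho>_def)
  have rename_h: "rename \<rho> (h (Suc e)) = complete_sym j (Suc e) + y * rename \<rho> (h e)" for e
    by (simp add: h_def complete_sym_Suc_Suc rename_add fixed rename_var_mult y_def)
      (simp add: \<rho>_def)
  have h_Suc: "h (Suc e) = complete_sym j (Suc e) + x * h e" for e
    by (simp add: h_def x_def complete_sym_Suc_Suc)
  \<comment> \<open>The recursions for the renamed and the original polynomial share the summand
    \<open>complete_sym j (Suc e)\<close>, which cancels in the difference.\<close>
  have "rename \<rho> (h (Suc d)) - h (Suc d) = (y - x) * complete_sym (Suc (Suc j)) d"
  proof (induction d)
    case 0
    show ?case
      using rename_h[of 0] h_Suc[of 0] by (simp add: h_def)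
  next
    case (Suc d)
    have "rename \<rho> (h (Suc (Suc d))) - h (Suc (Suc d))
        = (complete_sym j (Suc (Suc d)) + y * rename \<rho> (h (Suc d)))
          - (complete_sym j (Suc (Suc d)) + x * h (Suc d))"
      by (intro arg_cong2[where f = minus] rename_h h_Suc)
    also have "\<dots> = y * rename \<rho> (h (Suc d)) - x * h (Suc d)"
      by simp
    also have "\<dots> = y * (rename \<rho> (h (Suc d)) - h (Suc d)) + (y - x) * h (Suc d)"
      by (simp add: algebra_simps)
    also have "\<dots> = y * (y - x) * complete_sym (Suc (Suc j)) d + (y - x) * h (Suc d)"
      by (simp add: Suc.IH mult.assoc)
    \<comment> \<open>Variables commute, so the factor \<open>y - x\<close> can be brought to the
      front.\<close>
    also have "y * (y - x) = (y - x) * y"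
      unfolding x_def y_def by (rule var_diff_central)
    also have "(y - x) * y * complete_sym (Suc (Suc j)) d + (y - x) * h (Suc d)
        = (y - x) * (h (Suc d) + y * complete_sym (Suc (Suc j)) d)"
      by (simp add: distrib_left mult.assoc)
    also have "h (Suc d) + y * complete_sym (Suc (Suc j)) d = complete_sym (Suc (Suc j)) (Suc d)"
      by (simp only: h_def y_def complete_sym_Suc_Suc[of "Suc j" d])
    finally show ?case .
  qed
  then show ?thesis
    by (simp only: h_def \<rho>_def x_def y_def)
qed

text \<open>Convolution of arbitrary left coefficients with complete symmetric polynomials: a shape
  that divided differences preserve, lowering \<open>d\<close> and raising \<open>i\<close> by
  one.\<close>

definition sym_comb :: "(nat \<Rightarrow> 'a::ring_1) \<Rightarrow> nat \<Rightarrow> nat \<Rightarrow> 'a mpoly" where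
  "sym_comb c i d = (\<Sum>k\<le>d. const (c k) * complete_sym i (d - k))"

lemma sym_comb_divided_difference:
  "exact_quotient
      (rename (id(Suc j := Suc (Suc j))) (sym_comb c (Suc j) (Suc d)) - sym_comb c (Suc j) (Suc d))
      (var (Suc (Suc j)) - var (Suc j)) = sym_comb c (Suc (Suc j)) d"
    (is "exact_quotient (rename ?\<rho> ?p - ?p) ?D = ?q")
proof (rule exact_quotient_var_diff)
  \<comment> \<open>The summand at \<open>k = Suc d\<close> is the constant
    \<open>const (c (Suc d))\<close>, fixed by renaming; it cancels, so the sum stops at
    \<open>d\<close>.\<close>
  have "rename ?\<rho> ?p - ?p = (\<Sum>k\<le>d. const (c k) *
      (rename ?\<rho> (complete_sym (Suc j) (Suc (d - k))) - complete_sym (Suc j) (Suc (d - k))))"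
    by (simp add: sym_comb_def rename_add rename_const rename_sum rename_const_mult
        sum_subtractf right_diff_distrib Suc_diff_le)
  also have "\<dots> = ?D * ?q"
  proof -
    have "const (c k) * (?D * q) = ?D * (const (c k) * q)" for k q
      by (simp only: mult.assoc[symmetric] var_diff_central[of "const (c k)"])
    then show ?thesis
      by (simp only: complete_sym_shift_var sym_comb_def sum_distrib_left)
  qed
  finally show "rename ?\<rho> ?p - ?p = ?D * ?q" .
qed simp

section \<open>Vanishing of the alternating sums\<close>

definition alt_sym_sum :: "nat \<Rightarrow> nat \<Rightarrow> nat \<Rightarrow> 'a::ring_1 mpoly" where
  "alt_sym_sum n i d = (\<Sum>k\<le>d. elem_sym n k * (- 1) ^ k * complete_sym i (d - k))"

text \<open>With the variable on the right, it can be factored out of sums whose terms begin with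
  \<open>elem_sym\<close>.\<close>

lemma complete_sym_Suc_Suc':
  "complete_sym (Suc j) (Suc d) = complete_sym j (Suc d) + complete_sym (Suc j) d * var (Suc j)"
  by (simp only: complete_sym_Suc_Suc var_central)

text \<open>Raising \<open>i\<close> divides the generating function in \<open>t\<close> by
  \<open>1 - X_(i+1) t\<close>.\<close>

lemma alt_sym_sum_Suc_complete:
  "alt_sym_sum n (Suc i) (Suc d) = alt_sym_sum n i (Suc d) + var (Suc i) * alt_sym_sum n (Suc i) d"
proof -
  have "alt_sym_sum n (Suc i) (Suc d) = alt_sym_sum n i (Suc d) + alt_sym_sum n (Suc i) d * var (Suc i)"
    by (simp add: alt_sym_sum_def Suc_diff_le complete_sym_Suc_Suc' distrib_left sum.distrib
        sum_distrib_right mult.assoc)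
  then show ?thesis
    by (simp only: var_central)
qed

text \<open>Raising \<open>n\<close> multiplies the generating function by
  \<open>1 - X_(n+1) t\<close>.\<close>

lemma alt_sym_sum_Suc_elem:
  "alt_sym_sum (Suc n) i (Suc d) = alt_sym_sum n i (Suc d) - var (Suc n) * alt_sym_sum n i d"
  by (simp add: alt_sym_sum_def sum.atMost_Suc_shift elem_sym_Suc_Suc distrib_right sum.distrib
      sum_distrib_left mult.assoc sum_negf sum_subtractf del: sum.atMost_Suc)

text \<open>The generating function stays 1: raising both indices multiplies and divides by the same
  factor, so the terms with \<open>var (Suc n)\<close> cancel.\<close>

lemma alt_sym_sum_diagonal: "alt_sym_sum n n (Suc d) = 0"
proof (induction n)
  case 0
  show ?case
    by (simp add: alt_sym_sum_def sum.atMost_Suc_shift del: sum.atMost_Suc)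
next
  case (Suc n)
  show ?case
    by (simp add: alt_sym_sum_Suc_elem[of n "Suc n"] alt_sym_sum_Suc_complete[of n n] Suc)
qed

text \<open>The generating function of \<open>alt_sym_sum n i\<close> is the polynomial
  \<open>\<Prod>\<^bsub>i < l \<le> n\<^esub> (1 - X\<^sub>l t)\<close> of degree \<open>n - i\<close> in \<open>t\<close>.\<close>

lemma alt_sym_sum_eq_0: "alt_sym_sum (i + m) i (Suc (m + d)) = 0"
proof (induction m arbitrary: d)
  case 0
  show ?case
    by (simp add: alt_sym_sum_diagonal)
next
  case (Suc m)
  \<comment> \<open>The added variable combines the coefficients at \<open>Suc (m + Suc d)\<close>
    and \<open>Suc (m + d)\<close>, hence two instances of the induction hypothesis.\<close>
  show ?case
    using Suc[of d] Suc[of "Suc d"] by (simp add: alt_sym_sum_Suc_elem)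
qed

section \<open>Closed forms of the polynomials \<open>f_i\<close>\<close>

lemma eval_upoly_gen_poly:
  fixes a :: "nat \<Rightarrow> 'a::ring_1"
  shows "eval_upoly (gen_poly n a) p
     = p ^ n + (\<Sum>k=1..n. (- 1) ^ k * const (a k) * p ^ (n - k))"
proof -
  have "(- 1) ^ k * uconst (a k) * uvar ^ (n - k) = Poly_Mapping.single (n - k) ((- 1) ^ k * a k)" for k
    by (simp add: uconst_def uvar_def single_power mult_single single_uminus minus_one_power_iff)
  moreover have "(uvar :: 'a upoly) ^ n = Poly_Mapping.single n 1"
    by (simp add: uvar_def single_power)
  ultimately show ?thesis
    by (simp add: gen_poly_def eval_upoly_add eval_upoly_sum eval_upoly_single const_sign)
qed

text \<open>The coefficients of \<open>gen_poly\<close> from the top down; index 0 holds the leading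
  1, so that (b) becomes a single \<open>sym_comb\<close>.\<close>

definition signed_coeff :: "(nat \<Rightarrow> 'a::ring_1) \<Rightarrow> nat \<Rightarrow> 'a" where
  "signed_coeff a k = (if k = 0 then 1 else (- 1) ^ k * a k)"

lemma sum_atMost_split_0: "(\<Sum>k\<le>d. h k) = h 0 + (\<Sum>k=1..d. h k)" for h :: "nat \<Rightarrow> 'b::comm_monoid_add"
  by (simp add: atMost_atLeast0 sum.atLeast_Suc_atMost)

lemma sym_comb_signed_coeff:
  "sym_comb (signed_coeff a) i d
     = complete_sym i d + (\<Sum>k=1..d. (- 1) ^ k * const (a k) * complete_sym i (d - k))"
  by (simp add: sym_comb_def sum_atMost_split_0 signed_coeff_def const_sign)

text \<open>The start is \<open>S_1^d = X_1^d\<close>; each divided difference then trades one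
  degree for one more variable.\<close>

lemma f_poly_eq_sym_comb:
  assumes "Suc j \<le> n"
  shows "f_poly (gen_poly n a) (Suc j) = sym_comb (signed_coeff a) (Suc j) (n - j)"
  using assms
proof (induction j)
  case 0
  show ?case
    by (simp add: sym_comb_signed_coeff eval_upoly_gen_poly complete_sym_one)
next
  case (Suc j)
  then have "n - j = Suc (n - Suc j)"
    by simp
  with Suc show ?case
    by (simp add: Let_def sym_comb_divided_difference)
qed

text \<open>The bound on \<open>d\<close> makes \<open>alt_sym_sum n i d\<close> vanish, which
  expresses the leading \<open>complete_sym i d\<close> through the \<open>elem_sym n k\<close> with
  \<open>k \<ge> 1\<close>.\<close>

lemma sym_comb_signed_coeff_eq_generators:
  assumes "i \<le> n" "d > n - i"
  shows "sym_comb (signed_coeff a) i d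
    = (\<Sum>k=1..d. (- 1) ^ (k - 1) * (elem_sym n k - const (a k)) * complete_sym i (d - k))"
proof -
  have "alt_sym_sum n i d = 0"
    using alt_sym_sum_eq_0[of i "n - i" "d - Suc (n - i)"] assms by simp
  then have "complete_sym i d = - (\<Sum>k=1..d. elem_sym n k * (- 1) ^ k * complete_sym i (d - k))"
    by (simp add: alt_sym_sum_def sum_atMost_split_0 add_eq_0_iff2)
  then have "sym_comb (signed_coeff a) i d
    = (\<Sum>k=1..d. (- 1) ^ k * const (a k) * complete_sym i (d - k)
        - elem_sym n k * (- 1) ^ k * complete_sym i (d - k))"
    by (simp add: sym_comb_signed_coeff sum_subtractf)
  also have "\<dots> = (\<Sum>k=1..d. (- 1) ^ (k - 1) * (elem_sym n k - const (a k)) * complete_sym i (d - k))"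
  proof (rule sum.cong)
    fix k assume "k \<in> {1..d}"
    \<comment> \<open>For positive \<open>k\<close> the subtraction in \<open>k - 1\<close> is not
      truncated, and it flips the sign.\<close>
    then obtain l where "k = Suc l" by (cases k) auto
    then show "(- 1) ^ k * const (a k) * complete_sym i (d - k)
        - elem_sym n k * (- 1) ^ k * complete_sym i (d - k)
      = (- 1) ^ (k - 1) * (elem_sym n k - const (a k)) * complete_sym i (d - k)"
      by (simp add: minus_one_power_iff algebra_simps)
  qed simp
  finally show ?thesis .
qed

section \<open>Symmetry and degree\<close>

lemma lookup_complete_sym:
  "Poly_Mapping.lookup (complete_sym j d) m = (if m \<in> monomials j d then 1 else 0)"
  by (simp add: complete_sym_def lookup_sum lookup_single when_def finite_monomials)

lemma lookup_const_mult: "Poly_Mapping.lookup (const c * p) m = c * Poly_Mapping.lookup p m"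
proof -
  have "Poly_Mapping.lookup (const c *
      (\<Sum>k\<in>Poly_Mapping.keys p. Poly_Mapping.single k (Poly_Mapping.lookup p k))) m
    = c * Poly_Mapping.lookup p m"
    by (auto simp: const_def sum_distrib_left mult_single lookup_sum lookup_single when_def in_keys_iff)
  then show ?thesis
    by (simp only: poly_mapping_expansion)
qed

lemma keys_sym_comb:
  "Poly_Mapping.keys (sym_comb c i d) \<subseteq> (\<Union>k\<le>d. monomials i (d - k))"
  unfolding sym_comb_def
  by (rule order_trans[OF keys_sum])
    (auto simp: in_keys_iff lookup_const_mult lookup_complete_sym split: if_splits)

lemma symmetric_in_sym_comb: "symmetric_in i (sym_comb c i d)"
  unfolding symmetric_in_def
proof (intro conjI allI impI)
  show "sym_comb c i d \<in> poly_ring i"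
    using keys_sym_comb[of c i d] unfolding poly_ring_def monomials_def by blast
next
  fix \<pi> assume "\<pi> permutes {1..i}"
  then show "rename \<pi> (sym_comb c i d) = sym_comb c i d"
    by (simp add: sym_comb_def rename_sum rename_const_mult rename_complete_sym_permutes)
qed

lemma total_degree_sym_comb:
  assumes "i \<ge> 1" "c 0 = 1"
  shows "total_degree (sym_comb c i d) = d"
proof -
  let ?p = "sym_comb c i d" and ?m = "Poly_Mapping.single i d"
  \<comment> \<open>The power \<open>X_i^d\<close> occurs only in the summand \<open>k = 0\<close>,
    with coefficient \<open>c 0 = 1\<close>, so the degree bound is attained.\<close>
  have "Poly_Mapping.lookup ?p ?m = (\<Sum>k\<le>d. if k = 0 then 1 else 0)"
    unfolding sym_comb_def lookup_sum lookup_const_mult lookup_complete_sym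
    using assms by (intro sum.cong) (auto simp: monomials_def)
  then have "?m \<in> Poly_Mapping.keys ?p"
    by (simp add: in_keys_iff)
  then have "mono_degree ?m \<in> mono_degree ` Poly_Mapping.keys ?p"
    by (rule imageI)
  moreover have "mono_degree m \<le> d" if "m \<in> Poly_Mapping.keys ?p" for m
    using that keys_sym_comb[of c i d] by (auto simp: monomials_def)
  ultimately show ?thesis
    unfolding total_degree_def by (intro Max_eqI) auto
qed

section \<open>Equality of the generated ideals\<close>

lemma const_in_poly_ring: "const c \<in> poly_ring n"
  by (simp add: poly_ring_def const_def)

lemma complete_sym_in_poly_ring:
  assumes "i \<le> n"
  shows "complete_sym i d \<in> poly_ring n"
proof -
  have "Poly_Mapping.keys (complete_sym i d) \<subseteq> monomials i d"
    by (auto simp: in_keys_iff lookup_complete_sym split: if_splits)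
  moreover have "{1..i} \<subseteq> {1..n}"
    using assms by simp
  ultimately show ?thesis
    unfolding poly_ring_def monomials_def by blast
qed

text \<open>Triangular elimination. The closure properties asked of \<open>I\<close> are common to
  left and right ideals, so one argument serves both.\<close>

lemma generators_mem_iff:
  fixes g F :: "nat \<Rightarrow> 'a::ring_1 mpoly"
  assumes zero: "0 \<in> I"
    and add: "\<And>p q. p \<in> I \<Longrightarrow> q \<in> I \<Longrightarrow> p + q \<in> I"
    and minus: "\<And>p. p \<in> I \<Longrightarrow> - p \<in> I"
    and mult: "\<And>p i d. i \<le> n \<Longrightarrow> p \<in> I \<Longrightarrow> p * complete_sym i d \<in> I"
    and F: "\<And>i. i \<in> {1..n} \<Longrightarrow>
      F i = (\<Sum>k=1..n - i + 1. (- 1) ^ (k - 1) * g k * complete_sym i (n - i + 1 - k))"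
  shows "g ` {1..n} \<subseteq> I \<longleftrightarrow> F ` {1..n} \<subseteq> I"
proof
  have sign: "(- 1) ^ k * p \<in> I" if "p \<in> I" for p k
    using that minus by (simp add: minus_one_power_iff)
  have sum: "(\<Sum>k\<in>A. h k) \<in> I" if "\<And>k. k \<in> A \<Longrightarrow> h k \<in> I" for h :: "nat \<Rightarrow> _" and A
    using that by (induction A rule: infinite_finite_induct) (auto intro: zero add)
  show "F ` {1..n} \<subseteq> I" if g: "g ` {1..n} \<subseteq> I"
  proof clarify
    fix i assume i: "i \<in> {1..n}"
    have "g k \<in> I" if "k \<in> {1..n - i + 1}" for k
      using that i g by auto
    with i show "F i \<in> I"
      by (auto simp: F simp del: One_nat_def intro!: sum mult sign)
  qed
  show "g ` {1..n} \<subseteq> I" if F_mem: "F ` {1..n} \<subseteq> I"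
  proof clarify
    fix m assume "m \<in> {1..n}"
    then show "g m \<in> I"
    proof (induction m rule: less_induct)
      case (less m)
      then obtain d where d: "m = Suc d" by (cases m) auto
      \<comment> \<open>This index selects the relation whose last summand is
        \<open>(- 1) ^ d * g m\<close>, as \<open>complete_sym i 0 = 1\<close>; the others involve
        only \<open>g k\<close> with \<open>k < m\<close>.\<close>
      define i where "i = n - d"
      have i: "i \<in> {1..n}" "n - i + 1 = Suc d"
        using less.prems d by (auto simp: i_def)
      let ?s = "\<Sum>k=1..d. (- 1) ^ (k - 1) * g k * complete_sym i (Suc d - k)"
      have "?s \<in> I"
        using less i d by (auto intro!: sum mult sign)
      moreover have "F i \<in> I"
        using F_mem i(1) by blast
      ultimately have "F i + - ?s \<in> I"
        by (intro add minus)
      moreover have "F i = ?s + (- 1) ^ d * g m"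
        using i by (simp add: F d)
      ultimately have "(- 1) ^ d * g m \<in> I"
        by simp
      then have "(- 1) ^ d * ((- 1) ^ d * g m) \<in> I"
        by (rule sign)
      then show ?case
        by (simp add: mult.assoc[symmetric] power_add[symmetric])
    qed
  qed
qed

text \<open>Negation is multiplication by \<open>const (- 1)\<close>; right multiplication by
  \<open>complete_sym i d\<close> is available because this element is central.\<close>

lemma left_ideal_closed:
  assumes "left_ideal n I"
  shows "0 \<in> I" "\<And>p q. p \<in> I \<Longrightarrow> q \<in> I \<Longrightarrow> p + q \<in> I" "\<And>p. p \<in> I \<Longrightarrow> - p \<in> I"
    "\<And>p i d. i \<le> n \<Longrightarrow> p \<in> I \<Longrightarrow> p * complete_sym i d \<in> I"
proof -
  have mult: "r * p \<in> I" if "r \<in> poly_ring n" "p \<in> I" for r p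
    using assms that by (auto simp: left_ideal_def)
  show "- p \<in> I" if "p \<in> I" for p
    using mult[OF const_in_poly_ring[of "- 1"] that] by (simp add: const_minus)
  show "p * complete_sym i d \<in> I" if "i \<le> n" "p \<in> I" for p i d
    using mult[OF complete_sym_in_poly_ring that(2)] that(1) by (simp add: complete_sym_central)
qed (use assms in \<open>auto simp: left_ideal_def\<close>)

lemma right_ideal_closed:
  assumes "right_ideal n I"
  shows "0 \<in> I" "\<And>p q. p \<in> I \<Longrightarrow> q \<in> I \<Longrightarrow> p + q \<in> I" "\<And>p. p \<in> I \<Longrightarrow> - p \<in> I"
    "\<And>p i d. i \<le> n \<Longrightarrow> p \<in> I \<Longrightarrow> p * complete_sym i d \<in> I"
proof -
  have mult: "p * r \<in> I" if "r \<in> poly_ring n" "p \<in> I" for r p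
    using assms that by (auto simp: right_ideal_def)
  show "- p \<in> I" if "p \<in> I" for p
    using mult[OF const_in_poly_ring[of "- 1"] that] by (simp add: const_minus)
  show "p * complete_sym i d \<in> I" if "i \<le> n" "p \<in> I" for p i d
    using mult[OF complete_sym_in_poly_ring that(2)] that(1) by simp
qed (use assms in \<open>auto simp: right_ideal_def\<close>)

text \<open>A hull is the intersection of the \<open>S\<close>-sets containing the generators, so it
  depends only on which sets these are.\<close>

lemma hull_cong:
  assumes "\<And>I. S I \<Longrightarrow> A \<subseteq> I \<longleftrightarrow> B \<subseteq> I"
  shows "S hull A = S hull B"
  using assms unfolding hull_def by (metis (no_types, lifting))

theorem theorem2p1:
  fixes n :: nat
    and a :: "nat \<Rightarrow> 'a::ring_1"
    and f :: "'a upoly"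
    and g F :: "nat \<Rightarrow> 'a mpoly"
  assumes "n \<ge> 1"
    and "f = gen_poly n a"
    and "g = g_poly n a"
    and "F = f_poly f"
  shows
    "(left_ideal n hull (g ` {1..n}) = left_ideal n hull (F ` {1..n}) \<and>
      right_ideal n hull (g ` {1..n}) = right_ideal n hull (F ` {1..n}) \<and>
      two_sided_ideal n hull (g ` {1..n}) = two_sided_ideal n hull (F ` {1..n}))
     \<and>
     (\<forall>i\<in>{1..n}.
        F i = complete_sym i (n - i + 1)
              + (\<Sum>k=1..n - i + 1. (- 1) ^ k * const (a k) * complete_sym i (n - i + 1 - k)) \<and>
        symmetric_in i (F i) \<and>
        total_degree (F i) = n - (i - 1))
     \<and>
     (\<forall>i\<in>{1..n}.
        F i = (\<Sum>k=1..n - i + 1.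
                 (- 1) ^ (k - 1) * (elem_sym n k - const (a k)) * complete_sym i (n - i + 1 - k)))"
proof -
  have F: "F i = sym_comb (signed_coeff a) i (n - i + 1)" if "i \<in> {1..n}" for i
  proof -
    from that obtain j where "i = Suc j" by (cases i) auto
    with that show ?thesis
      using f_poly_eq_sym_comb[of j n a] by (simp add: assms Suc_diff_Suc)
  qed
  \<comment> \<open>The degree \<open>n - i + 1\<close> just exceeds \<open>n - i\<close>, so the
    alternating sum vanishes there.\<close>
  have Fg: "F i = (\<Sum>k=1..n - i + 1.
      (- 1) ^ (k - 1) * (elem_sym n k - const (a k)) * complete_sym i (n - i + 1 - k))"
    if "i \<in> {1..n}" for i
    using that sym_comb_signed_coeff_eq_generators[of i n "n - i + 1" a] by (simp add: F)
  then have Fg': "F i = (\<Sum>k=1..n - i + 1. (- 1) ^ (k - 1) * g k * complete_sym i (n - i + 1 - k))"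
    if "i \<in> {1..n}" for i
    using that by (simp add: assms g_poly_def)
  have left: "left_ideal n I \<Longrightarrow> g ` {1..n} \<subseteq> I \<longleftrightarrow> F ` {1..n} \<subseteq> I" for I
    by (rule generators_mem_iff[OF left_ideal_closed Fg'])
  have right: "right_ideal n I \<Longrightarrow> g ` {1..n} \<subseteq> I \<longleftrightarrow> F ` {1..n} \<subseteq> I" for I
    by (rule generators_mem_iff[OF right_ideal_closed Fg'])
  \<comment> \<open>A two-sided ideal is in particular a left ideal.\<close>
  have two: "two_sided_ideal n I \<Longrightarrow> g ` {1..n} \<subseteq> I \<longleftrightarrow> F ` {1..n} \<subseteq> I" for I
    using left by (simp add: two_sided_ideal_def)
  have "F i = complete_sym i (n - i + 1)
              + (\<Sum>k=1..n - i + 1. (- 1) ^ k * const (a k) * complete_sym i (n - i + 1 - k)) \<and>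
        symmetric_in i (F i) \<and> total_degree (F i) = n - (i - 1)" if "i \<in> {1..n}" for i
    unfolding F[OF that] using that
    by (intro conjI sym_comb_signed_coeff symmetric_in_sym_comb)
      (auto simp: total_degree_sym_comb signed_coeff_def)
  then show ?thesis
    using Fg hull_cong[of "left_ideal n", OF left] hull_cong[of "right_ideal n", OF right]
      hull_cong[of "two_sided_ideal n", OF two] by blast
qed

end
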